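(* Let $(Q,\cdot,\backslash,/)$ be a right division left cancelation groupoid which satisfies the Tarki associative law $x\cdot(z\cdot y)=(x\cdot y)\cdot z$ for all $x,y,z\in Q$. Then $(Q,\cdot)$ is a commutative group, and it satisfies each of the following identities for all $x,y,z\in Q$: $x\cdot(y\cdot z)=(x\cdot y)\cdot z$; $x\cdot(y\cdot z)=z\cdot(y\cdot x)$; $x\cdot(y\cdot z)=y\cdot(x\cdot z)$; $x\cdot(y\cdot z)=(z\cdot x)\cdot y$.
   Context: A groupoid $(Q,\cdot)$ is a non-empty set $Q$ with a binary operation $\cdot$. For $a\in Q$ let $L_a,R_a:Q\to Q$, $L_a x=a\cdot x$, $R_a x=x\cdot a$. The groupoid is a right division groupoid if $R_a$ is surjective for every $a\in Q$, and a left cancelation groupoid if $L_a$ is injective for every $a\in Q$. Writing a right division left cancelation groupoid as $(Q,\cdot,\backslash,/)$ means that $/$ and $\backslash$ are binary operations on $Q$ satisfying $(y/x)\cdot x=y$ and $x\backslash(x\cdot y)=y$ for all $x,y\in Q$. *)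

theory Defs
  imports "HOL-Algebra.Group"
begin

locale groupoid =
  fixes Q :: "'a set" and m :: "'a \<Rightarrow> 'a \<Rightarrow> 'a" (infixl \<open>\<cdot>\<close> 70)
  assumes nonempty: "Q \<noteq> {}"
    and closed: "\<And>x y. x \<in> Q \<Longrightarrow> y \<in> Q \<Longrightarrow> x \<cdot> y \<in> Q"

locale right_division_groupoid = groupoid +
  assumes right_translation_surj: "\<And>a. a \<in> Q \<Longrightarrow> (\<lambda>x. x \<cdot> a) ` Q = Q"

locale left_cancelation_groupoid = groupoid +
  assumes left_translation_inj: "\<And>a. a \<in> Q \<Longrightarrow> inj_on (\<lambda>x. a \<cdot> x) Q"

locale right_division_left_cancelation_groupoid =
  right_division_groupoid + left_cancelation_groupoid

(* The structure (Q, m, ld, rd): ld x y is x \<setminus> y and rd y x is y / x.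
   By the lemma below, the two translation conditions are redundant here. *)
locale right_division_left_cancelation_groupoid_ops =
  right_division_left_cancelation_groupoid Q m
  for Q :: "'a set" and m :: "'a \<Rightarrow> 'a \<Rightarrow> 'a" (infixl \<open>\<cdot>\<close> 70)
    and ld :: "'a \<Rightarrow> 'a \<Rightarrow> 'a" and rd :: "'a \<Rightarrow> 'a \<Rightarrow> 'a" +
  assumes ld_closed: "\<And>x y. x \<in> Q \<Longrightarrow> y \<in> Q \<Longrightarrow> ld x y \<in> Q"
    and rd_closed: "\<And>x y. x \<in> Q \<Longrightarrow> y \<in> Q \<Longrightarrow> rd x y \<in> Q"
    and rd_mult: "\<And>x y. x \<in> Q \<Longrightarrow> y \<in> Q \<Longrightarrow> rd y x \<cdot> x = y"
    and ld_mult: "\<And>x y. x \<in> Q \<Longrightarrow> y \<in> Q \<Longrightarrow> ld x (x \<cdot> y) = y"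

lemma right_division_left_cancelation_groupoid_opsI:
  assumes "groupoid Q m"
    and ld: "\<And>x y. x \<in> Q \<Longrightarrow> y \<in> Q \<Longrightarrow> ld x y \<in> Q"
    and rd: "\<And>x y. x \<in> Q \<Longrightarrow> y \<in> Q \<Longrightarrow> rd x y \<in> Q"
    and rdm: "\<And>x y. x \<in> Q \<Longrightarrow> y \<in> Q \<Longrightarrow> m (rd y x) x = y"
    and ldm: "\<And>x y. x \<in> Q \<Longrightarrow> y \<in> Q \<Longrightarrow> ld x (m x y) = y"
  shows "right_division_left_cancelation_groupoid_ops Q m ld rd"
proof -
  interpret groupoid Q m by fact
  show ?thesis
  proof
    fix a assume a: "a \<in> Q"
    show "(\<lambda>x. m x a) ` Q = Q"
    proof
      show "(\<lambda>x. m x a) ` Q \<subseteq> Q" using a closed by blast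
      show "Q \<subseteq> (\<lambda>x. m x a) ` Q"
      proof
        fix y assume "y \<in> Q"
        then show "y \<in> (\<lambda>x. m x a) ` Q"
          using a rd rdm by (intro image_eqI[where x = "rd y a"]) auto
      qed
    qed
    show "inj_on (\<lambda>x. m a x) Q"
      by (rule inj_on_inverseI[where g = "ld a"]) (use a ldm in auto)
  qed (use ld rd rdm ldm in auto)
qed

definition tarki_associative :: "'a set \<Rightarrow> ('a \<Rightarrow> 'a \<Rightarrow> 'a) \<Rightarrow> bool" where
  "tarki_associative Q m \<longleftrightarrow> (\<forall>x\<in>Q. \<forall>y\<in>Q. \<forall>z\<in>Q. m x (m z y) = m (m x y) z)"

(* The record's unit is not part of the data (Q, m), hence the existential. *)
definition is_commutative_group :: "'a set \<Rightarrow> ('a \<Rightarrow> 'a \<Rightarrow> 'a) \<Rightarrow> bool" where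
  "is_commutative_group Q m \<longleftrightarrow> (\<exists>e. comm_group \<lparr>carrier = Q, mult = m, one = e\<rparr>)"

end

theory Submission imports Defs begin

text \<open>
  The Tarki law reduces \<open>(yz)(yy)\<close> both to \<open>y(y(zy))\<close> and to \<open>y(y(yz))\<close>,
  so two left cancelations yield \<open>zy = yz\<close>.
  Commutativity turns the Tarki law into associativity, and right division
  supplies the identity and the inverses.
\<close>

lemma tarki_associativeD:
  assumes "tarki_associative Q m" "x \<in> Q" "y \<in> Q" "z \<in> Q"
  shows "m x (m z y) = m (m x y) z"
  using assms unfolding tarki_associative_def by blast

context left_cancelation_groupoid
begin

lemma left_cancel:
  assumes "a \<cdot> x = a \<cdot> y" "a \<in> Q" "x \<in> Q" "y \<in> Q"
  shows "x = y"
  using left_translation_inj[OF assms(2)] assms by (auto dest: inj_onD)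

lemma tarki_associative_imp_commute:
  assumes tarki: "tarki_associative Q (\<cdot>)" and y: "y \<in> Q" and z: "z \<in> Q"
  shows "y \<cdot> z = z \<cdot> y"
proof -
  note T = tarki_associativeD[OF tarki]
  have "y \<cdot> (y \<cdot> (z \<cdot> y)) = y \<cdot> ((y \<cdot> y) \<cdot> z)"
    using y z by (simp add: T)
  \<comment> \<open>The law is applied with \<open>y \<cdot> y\<close> as a single factor.\<close>
  also have "\<dots> = (y \<cdot> z) \<cdot> (y \<cdot> y)"
    using y z by (intro T closed)
  also have "\<dots> = ((y \<cdot> z) \<cdot> y) \<cdot> y"
    using y z by (intro T closed)
  also have "\<dots> = (y \<cdot> (y \<cdot> z)) \<cdot> y"
    using y z by (simp add: T)
  \<comment> \<open>Here \<open>y \<cdot> z\<close> is the single factor, and the law is read from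
    right to left.\<close>
  also have "\<dots> = y \<cdot> (y \<cdot> (y \<cdot> z))"
    using y z by (intro T[symmetric] closed)
  finally show ?thesis
    using y z by (metis left_cancel closed)
qed

text \<open>Commuting the inner product turns \<open>y \<cdot> z\<close> into
  \<open>z \<cdot> y\<close>, which gives the left side of the Tarki law.\<close>

lemma tarki_associative_imp_assoc:
  assumes tarki: "tarki_associative Q (\<cdot>)" and "x \<in> Q" "y \<in> Q" "z \<in> Q"
  shows "x \<cdot> (y \<cdot> z) = (x \<cdot> y) \<cdot> z"
  using assms tarki_associative_imp_commute[OF tarki] tarki_associativeD[OF tarki]
  by metis

end

context right_division_groupoid
begin

lemma right_divide:
  assumes "a \<in> Q" "b \<in> Q"
  obtains c where "c \<in> Q" "c \<cdot> a = b"
  using right_translation_surj[OF assms(1)] assms(2) by (metis imageE)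

text \<open>A commutative semigroup in which every equation \<open>c \<cdot> a = b\<close> has a
  solution \<open>c\<close> is a group: dividing an element by itself gives the unit, dividing the
  unit by \<open>x\<close> gives the inverse of \<open>x\<close>.\<close>

lemma is_commutative_groupI:
  assumes comm: "\<And>x y. x \<in> Q \<Longrightarrow> y \<in> Q \<Longrightarrow> x \<cdot> y = y \<cdot> x"
    and assoc: "\<And>x y z. x \<in> Q \<Longrightarrow> y \<in> Q \<Longrightarrow> z \<in> Q \<Longrightarrow> x \<cdot> (y \<cdot> z) = (x \<cdot> y) \<cdot> z"
  shows "is_commutative_group Q (\<cdot>)"
proof -
  obtain a where a: "a \<in> Q"
    using nonempty by blast
  \<comment> \<open>So far \<open>e\<close> fixes only the chosen \<open>a\<close>.\<close>
  obtain e where e: "e \<in> Q" "e \<cdot> a = a"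
    using right_divide[OF a a] .
  have e_left: "e \<cdot> b = b" if b: "b \<in> Q" for b
  proof -
    obtain c where c: "c \<in> Q" "c \<cdot> a = b"
      using right_divide[OF a b] .
    \<comment> \<open>Since \<open>b\<close> equals \<open>a \<cdot> c\<close> by commutativity,
      associativity carries the unit property from \<open>a\<close> to \<open>b\<close>.\<close>
    have "e \<cdot> (a \<cdot> c) = (e \<cdot> a) \<cdot> c"
      using a c e by (intro assoc)
    then show ?thesis
      using a c e comm by simp
  qed
  have "comm_group \<lparr>carrier = Q, mult = (\<cdot>), one = e\<rparr>"
  \<comment> \<open>With commutativity among its premises, this rule asks only for a left unit and
    left inverses.\<close>
  proof (rule comm_groupI)
    fix x assume "x \<in> carrier \<lparr>carrier = Q, mult = (\<cdot>), one = e\<rparr>"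
    then show "\<exists>y\<in>carrier \<lparr>carrier = Q, mult = (\<cdot>), one = e\<rparr>.
      y \<otimes>\<^bsub>\<lparr>carrier = Q, mult = (\<cdot>), one = e\<rparr>\<^esub> x = \<one>\<^bsub>\<lparr>carrier = Q, mult = (\<cdot>), one = e\<rparr>\<^esub>"
      using e(1) right_divide by auto metis
  qed (simp_all add: e e_left closed assoc, simp add: comm)
  then show ?thesis
    unfolding is_commutative_group_def by blast
qed

end

theorem theorem8:
  fixes Q :: "'a set"
    and m :: "'a \<Rightarrow> 'a \<Rightarrow> 'a" (infixl \<open>\<cdot>\<close> 70)
    and ld rd :: "'a \<Rightarrow> 'a \<Rightarrow> 'a"
  assumes "right_division_left_cancelation_groupoid_ops Q (\<cdot>) ld rd"
    and "tarki_associative Q (\<cdot>)"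
  shows "is_commutative_group Q (\<cdot>) \<and>
    (\<forall>x\<in>Q. \<forall>y\<in>Q. \<forall>z\<in>Q. x \<cdot> (y \<cdot> z) = (x \<cdot> y) \<cdot> z) \<and>
    (\<forall>x\<in>Q. \<forall>y\<in>Q. \<forall>z\<in>Q. x \<cdot> (y \<cdot> z) = z \<cdot> (y \<cdot> x)) \<and>
    (\<forall>x\<in>Q. \<forall>y\<in>Q. \<forall>z\<in>Q. x \<cdot> (y \<cdot> z) = y \<cdot> (x \<cdot> z)) \<and>
    (\<forall>x\<in>Q. \<forall>y\<in>Q. \<forall>z\<in>Q. x \<cdot> (y \<cdot> z) = (z \<cdot> x) \<cdot> y)"
proof -
  interpret right_division_left_cancelation_groupoid_ops Q "(\<cdot>)" ld rd
    by fact
  note comm = tarki_associative_imp_commute[OF assms(2)]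
  note assoc = tarki_associative_imp_assoc[OF assms(2)]
  \<comment> \<open>Each identity permutes and rebrackets one product of three factors.\<close>
  have "x \<cdot> (y \<cdot> z) = z \<cdot> (y \<cdot> x)" "x \<cdot> (y \<cdot> z) = y \<cdot> (x \<cdot> z)" "x \<cdot> (y \<cdot> z) = (z \<cdot> x) \<cdot> y"
    if "x \<in> Q" "y \<in> Q" "z \<in> Q" for x y z
    using that by (metis comm assoc closed)+
  then show ?thesis
    using is_commutative_groupI[OF comm assoc] assoc by blast
qed

end
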